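(* Let $k_1,k_2,N$ be positive integers. Then for every prime number $p$ and all positive integers $n_1,n_2,m_1,m_2\ge N$ with $n_1\equiv m_1 \pmod{p^{N-1}(p-1)}$ and $n_2\equiv m_2 \pmod{p^{N-1}(p-1)}$, we have $$\mathbb{B}_{n_1,n_2}^{(-k_1,-k_2)}\equiv\mathbb{B}_{n_1,m_2}^{(-k_1,-k_2)} \pmod{p^N},$$ $$\mathbb{B}_{n_1,n_2}^{(-k_1,-k_2)}\equiv\mathbb{B}_{m_1,n_2}^{(-k_1,-k_2)} \pmod{p^N}.$$
   Context: For integers $k_1,k_2$ and $|z_1|,|z_2|<1$ put $$\mathrm{Li}^{\mathrm{sh}}_{k_1,k_2}(z_1,z_2)=\sum_{1\le m_1<m_2}\frac{z_1^{m_1}z_2^{m_2-m_1}}{m_1^{k_1}m_2^{k_2}}.$$ The double-indexed poly-Bernoulli numbers $\mathbb{B}_{m_1,m_2}^{(k_1,k_2)}$ are defined by $$\frac{\mathrm{Li}^{\mathrm{sh}}_{k_1,k_2}(1-e^{-x_1-x_2},\,1-e^{-x_2})}{(1-e^{-x_1-x_2})(1-e^{-x_2})}=\sum_{m_1,m_2\ge0}\mathbb{B}_{m_1,m_2}^{(k_1,k_2)}\frac{x_1^{m_1}x_2^{m_2}}{m_1!\,m_2!}.$$ *)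

theory Defs
  imports "HOL-Analysis.Analysis" "HOL-Number_Theory.Cong"
begin

definition Li_sh :: "int \<Rightarrow> int \<Rightarrow> complex \<Rightarrow> complex \<Rightarrow> complex" where
  "Li_sh k1 k2 z1 z2 =
     (\<Sum>\<^sub>\<infinity>(m1, m2) \<in> {(m1, m2). 1 \<le> m1 \<and> m1 < m2}.
        z1 ^ m1 * z2 ^ (m2 - m1) / (of_nat m1 powi k1 * of_nat m2 powi k2))"

text \<open>
  The generating identity is required near the origin. On the lines where one of the denominators
  vanishes the quotient is only defined by continuous extension, so these points are left out
  (otherwise \<open>x / 0 = 0\<close> would make the identity false there); the remaining points are dense
  and determine the coefficients.
\<close>

definition is_double_poly_bernoulli :: "int \<Rightarrow> int \<Rightarrow> (nat \<Rightarrow> nat \<Rightarrow> complex) \<Rightarrow> bool" where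
  "is_double_poly_bernoulli k1 k2 B \<longleftrightarrow>
     (\<forall>\<^sub>F (x1, x2) in nhds (0, 0).
        1 - exp (- x1 - x2) \<noteq> 0 \<and> 1 - exp (- x2) \<noteq> 0 \<longrightarrow>
        ((\<lambda>(m1, m2). B m1 m2 * (x1 ^ m1 * x2 ^ m2 / (fact m1 * fact m2))) has_sum
          Li_sh k1 k2 (1 - exp (- x1 - x2)) (1 - exp (- x2)) /
            ((1 - exp (- x1 - x2)) * (1 - exp (- x2)))) UNIV)"

definition double_poly_bernoulli :: "int \<Rightarrow> int \<Rightarrow> nat \<Rightarrow> nat \<Rightarrow> complex" where
  "double_poly_bernoulli k1 k2 = (THE B. is_double_poly_bernoulli k1 k2 B)"

text \<open>
  Congruence of complex numbers that are integers. Integrality is part of the assertion; the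
  relation \<open>cong\<close> itself is not usable at a field type.
\<close>

definition cong_integers :: "complex \<Rightarrow> complex \<Rightarrow> int \<Rightarrow> bool" where
  "cong_integers x y m \<longleftrightarrow> (\<exists>a b :: int. x = of_int a \<and> y = of_int b \<and> [a = b] (mod m))"

end

theory Submission
  imports Defs "HOL-Number_Theory.Residues"
begin

text \<open>
  For nonpositive upper indices the numbers are exponential sums with integer coefficients, and
  each exponential is periodic modulo a prime power.

  Substituting \<open>m2 = m1 + n\<close> and expanding \<open>(m1 + n) ^ b\<close> binomially splits \<open>Li_sh (- a) (- b)\<close> into
  products of one-variable series \<open>\<Sum> m ^ c z ^ m\<close>. Expanding a power in rising
  factorials turns each of these, divided by \<open>z\<close>, into an integer combination of powers of
  \<open>1 / (1 - z)\<close> (\<open>has_sum_power_times_geometric\<close>). At \<open>z1 = 1 - exp (- x1 - x2)\<close> and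
  \<open>z2 = 1 - exp (- x2)\<close> these are powers of \<open>exp (x1 + x2)\<close> and \<open>exp x2\<close>, so the generating
  function is a finite integer combination of exponentials \<open>exp (u x1) exp (v x2)\<close> with positive
  integers \<open>u\<close>, \<open>v\<close>, and the number with lower indices \<open>n1\<close>, \<open>n2\<close> is the same combination of \<open>u ^ n1 v ^ n2\<close>
  (\<open>double_poly_bernoulli_neg\<close>).

  Modulo \<open>p ^ N\<close>, the power \<open>u ^ n\<close> depends for \<open>n \<ge> N\<close> only on \<open>n\<close> modulo
  \<open>p ^ (N - 1) (p - 1)\<close>: by Euler's theorem if \<open>p\<close> does not divide \<open>u\<close>, and because the power
  vanishes if it does (\<open>power_cong_prime_power\<close>).

  Reading off the coefficients needs the generating identity to determine them, although it is
  available only away from the lines \<open>x2 = 0\<close> and \<open>x1 + x2 = 0\<close>. The cone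
  \<open>0 < norm x1 < norm x2\<close> avoids both lines and is large enough to apply the
  one-variable identity theorem twice (\<open>double_powser_eq_0_imp_coeffs_eq_0\<close>).
\<close>

section \<open>Infinite sums\<close>

lemma has_sum_product_complex:
  fixes f :: "'a \<Rightarrow> complex" and g :: "'b \<Rightarrow> complex"
  assumes f: "(f has_sum s) A" and g: "(g has_sum t) B"
  shows "((\<lambda>(x, y). f x * g y) has_sum s * t) (A \<times> B)"
proof (rule has_sum_SigmaI)
  show "((\<lambda>y. case (x, y) of (x, y) \<Rightarrow> f x * g y) has_sum f x * t) B" for x
    using has_sum_cmult_right[OF g] by simp
  show "((\<lambda>x. f x * t) has_sum s * t) A"
    using has_sum_cmult_left[OF f] .
  have fa: "(\<lambda>x. norm (f x)) summable_on A" and ga: "(\<lambda>y. norm (g y)) summable_on B"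
    using f g by (auto dest!: has_sum_imp_summable simp: summable_on_iff_abs_summable_on_complex)
  have "(\<lambda>p. norm (f (fst p) * g (snd p))) summable_on A \<times> B"
  proof (rule summable_on_SigmaI)
    show "((\<lambda>y. norm (f (fst (x, y)) * g (snd (x, y)))) has_sum
            norm (f x) * infsum (\<lambda>y. norm (g y)) B) B" for x
      using has_sum_cmult_right[OF has_sum_infsum[OF ga]] by (simp add: norm_mult)
    show "(\<lambda>x. norm (f x) * infsum (\<lambda>y. norm (g y)) B) summable_on A"
      using summable_on_cmult_left[OF fa] .
  qed auto
  then show "(\<lambda>(x, y). f x * g y) summable_on A \<times> B"
    by (simp add: summable_on_iff_abs_summable_on_complex case_prod_unfold)
qed

lemma has_sum_finite_sum:
  fixes f :: "'i \<Rightarrow> 'a \<Rightarrow> 'b :: topological_comm_monoid_add"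
  assumes "\<And>i. i \<in> I \<Longrightarrow> (f i has_sum s i) A"
  shows "((\<lambda>x. \<Sum>i\<in>I. f i x) has_sum (\<Sum>i\<in>I. s i)) A"
  using assms by (induction I rule: infinite_finite_induct) (auto intro: has_sum_add)

lemma has_sum_exp:
  fixes x :: complex
  shows "((\<lambda>n. x ^ n / fact n) has_sum exp x) UNIV"
proof (rule norm_summable_imp_has_sum)
  show "summable (\<lambda>n. norm (x ^ n / fact n))"
    using summable_norm_exp[of x] by (simp add: scaleR_conv_of_real divide_inverse mult.commute)
  show "(\<lambda>n. x ^ n / fact n) sums exp x"
    using exp_converges[of x] by (simp add: scaleR_conv_of_real divide_inverse mult.commute)
qed

text \<open>
  This is the binomial series with exponent \<open>- (i + 1)\<close>. Absolute convergence, which unordered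
  summation requires, is the same series at the nonnegative point \<open>norm z\<close>.
\<close>

lemma has_sum_binomial_negative_power:
  fixes z :: complex
  assumes "norm z < 1"
  shows "((\<lambda>m. of_nat ((m + i) choose i) * z ^ m) has_sum inverse (1 - z) ^ Suc i) UNIV"
proof -
  have coeff: "((- of_nat (Suc i)) gchoose m) * (- w) ^ m = of_nat ((m + i) choose i) * w ^ m"
    for m and w :: complex
  proof -
    have "((- of_nat (Suc i) :: complex) gchoose m) = (-1) ^ m * (of_nat (m + i) gchoose m)"
      by (subst gbinomial_minus) (simp add: add.commute)
    also have "\<dots> = (-1) ^ m * of_nat ((m + i) choose i)"
      using binomial_symmetric[of m "m + i"]
      by (simp add: binomial_gbinomial [symmetric] del: of_nat_add)
    finally have "((- of_nat (Suc i)) gchoose m) * (- w) ^ m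
        = ((-1) ^ m * (- w) ^ m) * of_nat ((m + i) choose i)"
      by simp
    also have "(-1) ^ m * (- w) ^ m = w ^ m"
      by (simp flip: power_mult_distrib)
    finally show ?thesis by (simp add: mult.commute)
  qed
  have sums: "(\<lambda>m. of_nat ((m + i) choose i) * w ^ m) sums (1 - w) powr (- of_nat (Suc i))"
    if "norm w < 1" for w :: complex
    using gen_binomial_complex[of "- w" "- of_nat (Suc i)"] that unfolding coeff by simp
  have "summable (\<lambda>m. of_nat ((m + i) choose i) * complex_of_real (norm z) ^ m)"
    using sums[of "of_real (norm z)"] assms by (simp add: sums_iff)
  then have "summable (\<lambda>m. complex_of_real (of_nat ((m + i) choose i) * norm z ^ m))"
    by simp
  then have "summable (\<lambda>m. norm (of_nat ((m + i) choose i) * z ^ m))"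
    unfolding summable_of_real_iff by (simp add: norm_mult norm_power)
  moreover have "(1 - z) powr (- of_nat (Suc i)) = inverse (1 - z) ^ Suc i"
  proof -
    have "1 - z \<noteq> 0" using assms by auto
    then show ?thesis using powr_nat'[of "1 - z" "Suc i"]
      by (simp add: powr_minus power_inverse del: of_nat_Suc power_Suc)
  qed
  ultimately show ?thesis
    using sums[OF assms] by (auto intro: norm_summable_imp_has_sum)
qed

section \<open>Uniqueness of the coefficients\<close>

text \<open>
  Once the coefficients below \<open>n\<close> vanish, the series can be divided by \<open>x ^ n\<close>, and its limit
  at the origin is the \<open>n\<close>-th coefficient.
\<close>

lemma powser_eq_0_imp_coeffs_eq_0:
  fixes a :: "nat \<Rightarrow> complex"
  assumes "r > 0" and "\<And>x. x \<noteq> 0 \<Longrightarrow> norm x < r \<Longrightarrow> (\<lambda>n. a n * x ^ n) sums 0"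
  shows "a n = 0"
proof (induction n rule: less_induct)
  case (less n)
  have "(\<lambda>k. a (k + n) * x ^ k) sums 0" if "x \<noteq> 0" "norm x < r" for x
  proof -
    have "(\<lambda>k. a (k + n) * x ^ (k + n)) sums (0 - (\<Sum>i<n. a i * x ^ i))"
      using assms(2)[OF that] by (subst sums_iff_shift) simp
    then have "(\<lambda>k. (a (k + n) * x ^ (k + n)) / x ^ n) sums ((0 - (\<Sum>i<n. a i * x ^ i)) / x ^ n)"
      by (rule sums_divide)
    then show ?thesis
      using less.IH that by (simp add: power_add)
  qed
  then have "((\<lambda>_. 0) \<longlongrightarrow> a n) (at (0 :: complex))"
    using powser_limit_0_strong[OF \<open>r > 0\<close>, of "\<lambda>k. a (k + n)"] by simp
  then show ?case
    using tendsto_unique[OF _ _ tendsto_const] by (metis trivial_limit_at)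
qed

text \<open>
  For fixed \<open>y\<close> the double series is a power series in \<open>x\<close> vanishing on a punctured disc, so its
  coefficients, which are power series in \<open>y\<close>, vanish; then the same argument applies to \<open>y\<close>. The
  discs in \<open>x\<close> may shrink with \<open>y\<close>, so vanishing on a cone suffices.
\<close>

lemma double_powser_eq_0_imp_coeffs_eq_0:
  fixes D :: "nat \<Rightarrow> nat \<Rightarrow> complex"
  assumes "r > 0"
    and zero: "\<And>x y. x \<noteq> 0 \<Longrightarrow> norm x < norm y \<Longrightarrow> norm y < r \<Longrightarrow>
      ((\<lambda>(m, n). D m n * (x ^ m * y ^ n)) has_sum 0) UNIV"
  shows "D m n = 0"
proof -
  have inner: "(\<lambda>n. D m n * y ^ n) sums 0" if y: "y \<noteq> 0" "norm y < r" for m y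
  proof -
    (* Convergence at one nonzero x, here y / 2, gives convergence of every row. *)
    have row: "(\<lambda>n. D m n * y ^ n) summable_on UNIV" for m
    proof -
      have "(\<lambda>(m, n). D m n * ((y / 2) ^ m * y ^ n)) summable_on UNIV \<times> UNIV"
        using zero[of "y / 2" y] y by (auto simp: norm_divide dest: has_sum_imp_summable)
      from summable_on_SigmaD1[OF this, of m]
      have "(\<lambda>n. (D m n * y ^ n) * (y / 2) ^ m) summable_on UNIV"
        by (simp add: mult_ac)
      then show ?thesis
        using y by (subst (asm) summable_on_cmult_left') auto
    qed
    define c where "c m = infsum (\<lambda>n. D m n * y ^ n) UNIV" for m
    have c: "((\<lambda>n. D m n * y ^ n) has_sum c m) UNIV" for m
      unfolding c_def using row by (rule has_sum_infsum)
    have "(\<lambda>m. c m * x ^ m) sums 0" if "x \<noteq> 0" "norm x < norm y" for x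
    proof -
      have "((\<lambda>m. c m * x ^ m) has_sum 0) UNIV"
      proof (rule has_sum_SigmaD)
        show "((\<lambda>(m, n). D m n * (x ^ m * y ^ n)) has_sum 0) (UNIV \<times> UNIV)"
          using zero[of x y] that y by simp
        show "((\<lambda>n. case (m, n) of (m, n) \<Rightarrow> D m n * (x ^ m * y ^ n)) has_sum c m * x ^ m) UNIV"
          for m
          using has_sum_cmult_left[OF c[of m], of "x ^ m"] by (simp add: mult_ac)
      qed
      then show ?thesis by (rule has_sum_imp_sums)
    qed
    then have "c m = 0"
      using powser_eq_0_imp_coeffs_eq_0[of "norm y" c m] y by simp
    then show ?thesis
      using c[of m] by (auto dest: has_sum_imp_sums)
  qed
  show ?thesis
    by (rule powser_eq_0_imp_coeffs_eq_0[OF \<open>r > 0\<close> inner])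
qed

text \<open>
  Near the origin \<open>1 - exp (- w)\<close> vanishes only at \<open>w = 0\<close>, and on the cone \<open>0 < norm x < norm y\<close>
  neither \<open>y\<close> nor \<open>x + y\<close> is zero; hence the defining identity is available there for both
  families, and their difference has zero sum.
\<close>

lemma is_double_poly_bernoulli_unique:
  assumes "is_double_poly_bernoulli k1 k2 B" and "is_double_poly_bernoulli k1 k2 B'"
  shows "B = B'"
proof -
  have "\<forall>\<^sub>F p in nhds (0 :: complex \<times> complex).
      1 - exp (- fst p - snd p) \<noteq> 0 \<and> 1 - exp (- snd p) \<noteq> 0 \<longrightarrow>
        ((\<lambda>(m, n). (B m n - B' m n) * (fst p ^ m * snd p ^ n / (fact m * fact n))) has_sum 0) UNIV"
    using assms[unfolded is_double_poly_bernoulli_def case_prod_unfold, folded zero_prod_def]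
  proof eventually_elim
    case (elim p)
    show ?case
    proof
      let ?t = "\<lambda>q. fst p ^ fst q * snd p ^ snd q / (fact (fst q) * fact (snd q))"
      assume "1 - exp (- fst p - snd p) \<noteq> 0 \<and> 1 - exp (- snd p) \<noteq> 0"
      with elim obtain S where "((\<lambda>q. B (fst q) (snd q) * ?t q) has_sum S) UNIV"
        and "((\<lambda>q. B' (fst q) (snd q) * ?t q) has_sum S) UNIV"
        by blast
      then have "((\<lambda>q. B (fst q) (snd q) * ?t q + (-1) * (B' (fst q) (snd q) * ?t q))
          has_sum S + (-1) * S) UNIV"
        by (intro has_sum_add has_sum_cmult_right)
      then show "((\<lambda>(m, n). (B m n - B' m n) * (fst p ^ m * snd p ^ n / (fact m * fact n)))
          has_sum 0) UNIV"
        by (simp add: left_diff_distrib diff_divide_distrib case_prod_unfold)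
    qed
  qed
  then obtain e where e: "e > 0" and E: "\<And>p :: complex \<times> complex. norm p < e \<Longrightarrow>
      1 - exp (- fst p - snd p) \<noteq> 0 \<Longrightarrow> 1 - exp (- snd p) \<noteq> 0 \<Longrightarrow>
        ((\<lambda>(m, n). (B m n - B' m n) * (fst p ^ m * snd p ^ n / (fact m * fact n))) has_sum 0) UNIV"
    unfolding eventually_nhds_metric by auto
  define D where "D m n = (B m n - B' m n) / (fact m * fact n)" for m n
  have exp_ne: "1 - exp (- w) \<noteq> 0" if "w \<noteq> 0" "norm w < 2 * pi" for w :: complex
    using exp_complex_eqI[of "- w" 0] that abs_Im_le_cmod[of w] by fastforce
  have "D m n = 0" for m n
  proof (rule double_powser_eq_0_imp_coeffs_eq_0[where D = D])
    show "min (e / 2) pi > 0" using e by simp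
    fix x y :: complex
    assume xy: "x \<noteq> 0" "norm x < norm y" "norm y < min (e / 2) pi"
    have "norm (x, y) < e"
      using norm_Pair_le[of x y] xy by linarith
    moreover have "x + y \<noteq> 0"
      using xy by (metis add_eq_0_iff norm_minus_cancel order_less_irrefl)
    then have "1 - exp (- x - y) \<noteq> 0"
      using exp_ne[of "x + y"] norm_triangle_ineq[of x y] xy by simp
    moreover have "1 - exp (- y) \<noteq> 0"
      using exp_ne[of y] xy pi_gt_zero by (smt (verit) norm_ge_zero norm_zero)
    ultimately show "((\<lambda>(m, n). D m n * (x ^ m * y ^ n)) has_sum 0) UNIV"
      using E[of "(x, y)"] by (simp add: D_def)
  qed
  then show ?thesis by (auto simp: D_def fun_eq_iff)
qed

section \<open>The generating function as a sum of exponentials\<close>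

text \<open>
  In terms of Stirling numbers of the second kind, \<open>rising_coeff c i = (- 1) ^ (c - i) i! S(c, i)\<close>
  for \<open>i \<le> c\<close>. These are the coefficients of \<open>x ^ c\<close> in the basis \<open>x (x + 1) \<dots> (x + i - 1) / i!\<close>,
  and the recursion comes from multiplying by \<open>x\<close>. At \<open>i = 0\<close> the truncated \<open>i - 1\<close> does no harm
  because of the factor \<open>i\<close>.
\<close>

fun rising_coeff :: "nat \<Rightarrow> nat \<Rightarrow> int" where
  "rising_coeff 0 i = (if i = 0 then 1 else 0)"
| "rising_coeff (Suc c) i = int i * (rising_coeff c (i - 1) - rising_coeff c i)"

lemma rising_coeff_eq_0: "c < i \<Longrightarrow> rising_coeff c i = 0"
  by (induction c arbitrary: i) auto

lemma power_eq_sum_rising_coeff: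
  "int (Suc m) ^ c = (\<Sum>i\<le>c. rising_coeff c i * int ((m + i) choose i))"
proof (induction c)
  case 0
  then show ?case by simp
next
  case (Suc c)
  have step: "int (Suc m) * int ((m + i) choose i)
      = int (Suc i) * int ((m + Suc i) choose Suc i) - int i * int ((m + i) choose i)" for i
  proof -
    have "Suc i * ((m + Suc i) choose Suc i) = (m + Suc i) * ((m + i) choose i)"
      using Suc_times_binomial_eq[of "m + i" i] by simp
    then have "int (Suc i) * int ((m + Suc i) choose Suc i) = int (m + Suc i) * int ((m + i) choose i)"
      by (metis of_nat_mult)
    then show ?thesis by (simp add: algebra_simps)
  qed
  have "int (Suc m) ^ Suc c
      = (\<Sum>i\<le>c. rising_coeff c i * (int (Suc m) * int ((m + i) choose i)))"
    by (simp only: power_Suc Suc.IH sum_distrib_left mult.left_commute)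
  also have "\<dots> = (\<Sum>i\<le>c. int (Suc i) * rising_coeff c i * int ((m + Suc i) choose Suc i))
      - (\<Sum>i\<le>c. int i * rising_coeff c i * int ((m + i) choose i))"
    unfolding step by (simp only: sum_subtractf[symmetric] right_diff_distrib mult_ac)
  also have "(\<Sum>i\<le>c. int (Suc i) * rising_coeff c i * int ((m + Suc i) choose Suc i))
      = (\<Sum>i\<le>Suc c. int i * rising_coeff c (i - 1) * int ((m + i) choose i))"
    by (subst sum.atMost_Suc_shift) simp
  also have "(\<Sum>i\<le>c. int i * rising_coeff c i * int ((m + i) choose i))
      = (\<Sum>i\<le>Suc c. int i * rising_coeff c i * int ((m + i) choose i))"
    by (simp add: rising_coeff_eq_0)
  finally show ?case
    by (simp only: sum_subtractf[symmetric] rising_coeff.simps algebra_simps)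
qed

text \<open>
  Summing the expansion of \<open>(m + 1) ^ c\<close> termwise. What matters later is that the value is an integer
  combination of powers of \<open>1 / (1 - z)\<close>, each of which becomes an exponential after the
  substitution \<open>z = 1 - exp (- t)\<close>.
\<close>

lemma has_sum_power_times_geometric:
  fixes z :: complex
  assumes "norm z < 1"
  shows "((\<lambda>m. of_nat (Suc m) ^ c * z ^ m) has_sum
    (\<Sum>i\<le>c. of_int (rising_coeff c i) * inverse (1 - z) ^ Suc i)) UNIV"
proof -
  have "((\<lambda>m. \<Sum>i\<le>c. of_int (rising_coeff c i) * (of_nat ((m + i) choose i) * z ^ m)) has_sum
      (\<Sum>i\<le>c. of_int (rising_coeff c i) * inverse (1 - z) ^ Suc i)) UNIV"
    by (intro has_sum_finite_sum has_sum_cmult_right has_sum_binomial_negative_power assms)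
  also have "(\<lambda>m. \<Sum>i\<le>c. of_int (rising_coeff c i) * (of_nat ((m + i) choose i) * z ^ m))
      = (\<lambda>m. of_nat (Suc m) ^ c * z ^ m)"
  proof
    fix m
    have "(of_nat (Suc m) :: complex) ^ c = of_int (int (Suc m) ^ c)"
      by simp
    also have "\<dots> = (\<Sum>i\<le>c. of_int (rising_coeff c i) * of_nat ((m + i) choose i))"
      unfolding power_eq_sum_rising_coeff by simp
    finally show "(\<Sum>i\<le>c. of_int (rising_coeff c i) * (of_nat ((m + i) choose i) * z ^ m))
        = of_nat (Suc m) ^ c * z ^ m"
      by (simp only: sum_distrib_right mult.assoc)
  qed
  finally show ?thesis .
qed

text \<open>
  The exponent of \<open>z2\<close> is the difference \<open>n = m2 - m1\<close>, so in the coordinates \<open>(m1, n)\<close> the summation range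
  is a full quadrant and, after the binomial expansion of \<open>m2 ^ b = (m1 + n) ^ b\<close>, the
  variables separate. The factor \<open>z1 * z2\<close> in front cancels the denominator of the generating function.
\<close>

lemma Li_sh_neg:
  fixes z1 z2 :: complex
  assumes z: "norm z1 < 1" "norm z2 < 1"
  shows "Li_sh (- int a) (- int b) z1 z2 = z1 * z2 *
    (\<Sum>j\<le>b. of_nat (b choose j) *
      ((\<Sum>i\<le>a + j. of_int (rising_coeff (a + j) i) * inverse (1 - z1) ^ Suc i) *
       (\<Sum>l\<le>b - j. of_int (rising_coeff (b - j) l) * inverse (1 - z2) ^ Suc l)))"
    (is "_ = z1 * z2 * ?S")
proof -
  have "((\<lambda>q. z1 * z2 * (\<Sum>j\<le>b. of_nat (b choose j) *
      (\<lambda>(m, n). (of_nat (Suc m) ^ (a + j) * z1 ^ m) * (of_nat (Suc n) ^ (b - j) * z2 ^ n)) q))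
      has_sum z1 * z2 * ?S) (UNIV \<times> UNIV)"
    by (intro has_sum_cmult_right has_sum_finite_sum has_sum_product_complex
        has_sum_power_times_geometric z)
  also have "?this \<longleftrightarrow> ((\<lambda>(m1, m2). z1 ^ m1 * z2 ^ (m2 - m1) /
        (of_nat m1 powi (- int a) * of_nat m2 powi (- int b))) has_sum z1 * z2 * ?S)
      {(m1, m2). 1 \<le> m1 \<and> m1 < m2}"
  proof (rule has_sum_reindex_bij_witness[where
        i = "\<lambda>(m1, m2). (m1 - 1, m2 - m1 - 1)" and j = "\<lambda>(m, n). (Suc m, Suc m + Suc n)"])
    fix q :: "nat \<times> nat" assume "q \<in> UNIV \<times> UNIV"
    obtain m n where q: "q = (m, n)" by fastforce
    have "(of_nat (Suc m + Suc n) :: complex) ^ b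
        = (\<Sum>j\<le>b. of_nat (b choose j) * of_nat (Suc m) ^ j * of_nat (Suc n) ^ (b - j))"
      unfolding of_nat_add by (rule binomial_ring)
    then have "z1 ^ Suc m * z2 ^ Suc n * (of_nat (Suc m) ^ a * of_nat (Suc m + Suc n) ^ b)
        = z1 * z2 * (\<Sum>j\<le>b. of_nat (b choose j) *
            ((of_nat (Suc m) ^ (a + j) * z1 ^ m) * (of_nat (Suc n) ^ (b - j) * z2 ^ n)))"
      by (simp only: sum_distrib_left power_add power_Suc mult_ac)
    then show "(case case q of (m, n) \<Rightarrow> (Suc m, Suc m + Suc n) of (m1, m2) \<Rightarrow>
         z1 ^ m1 * z2 ^ (m2 - m1) / (of_nat m1 powi (- int a) * of_nat m2 powi (- int b)))
        = z1 * z2 * (\<Sum>j\<le>b. of_nat (b choose j) *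
      (\<lambda>(m, n). (of_nat (Suc m) ^ (a + j) * z1 ^ m) * (of_nat (Suc n) ^ (b - j) * z2 ^ n)) q)"
      by (simp add: q power_int_minus field_simps del: of_nat_Suc of_nat_add)
  qed auto
  finally show ?thesis
    unfolding Li_sh_def by (rule infsumI)
qed

text \<open>
  The double poly-Bernoulli number with upper indices \<open>- a\<close>, \<open>- b\<close>. The bases arise from
  \<open>exp (x1 + x2) ^ (i + 1) * exp x2 ^ (l + 1)\<close>: collecting exponents, \<open>x1\<close> carries \<open>i + 1\<close> and \<open>x2\<close>
  carries \<open>(i + 1) + (l + 1)\<close>.
\<close>

definition neg_double_poly_bernoulli :: "nat \<Rightarrow> nat \<Rightarrow> nat \<Rightarrow> nat \<Rightarrow> int" where
  "neg_double_poly_bernoulli a b n1 n2 =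
     (\<Sum>j\<le>b. \<Sum>i\<le>a + j. \<Sum>l\<le>b - j.
        int (b choose j) * rising_coeff (a + j) i * rising_coeff (b - j) l *
          (int (Suc i) ^ n1 * int (Suc i + Suc l) ^ n2))"

lemma is_double_poly_bernoulli_neg:
  "is_double_poly_bernoulli (- int a) (- int b)
     (\<lambda>n1 n2. of_int (neg_double_poly_bernoulli a b n1 n2))"
proof -
  have small: "\<forall>\<^sub>F (x1, x2) in nhds (0 :: complex, 0 :: complex).
      norm (1 - exp (- x1 - x2)) < 1 \<and> norm (1 - exp (- x2)) < 1"
  proof -
    have "open {p :: complex \<times> complex. norm (1 - exp (- fst p - snd p)) < 1 \<and>
        norm (1 - exp (- snd p)) < 1}"
      by (intro open_Collect_conj open_Collect_less continuous_intros)
    then show ?thesis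
      unfolding eventually_nhds by (intro exI conjI) (auto simp: case_prod_unfold)
  qed
  show ?thesis
    unfolding is_double_poly_bernoulli_def
    using small
  proof (eventually_elim, clarify)
    fix x1 x2 :: complex
    define z1 z2 where "z1 = 1 - exp (- x1 - x2)" and "z2 = 1 - exp (- x2)"
    assume z: "norm (1 - exp (- x1 - x2)) < 1" "norm (1 - exp (- x2)) < 1"
    assume nz: "1 - exp (- x1 - x2) \<noteq> 0" "1 - exp (- x2) \<noteq> 0"
    define C :: "nat \<Rightarrow> nat \<Rightarrow> nat \<Rightarrow> complex" where
      "C j i l = of_nat (b choose j) * of_int (rising_coeff (a + j) i) * of_int (rising_coeff (b - j) l)"
      for j i l
    have inv: "inverse (1 - z1) ^ Suc i * inverse (1 - z2) ^ Suc l
        = exp (of_nat (Suc i) * x1) * exp (of_nat (Suc i + Suc l) * x2)" for i l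
    proof -
      have "inverse (1 - z1) = exp (x1 + x2)" "inverse (1 - z2) = exp x2"
        by (simp_all add: z1_def z2_def add.commute flip: exp_minus)
      then show ?thesis
        by (simp only: exp_of_nat_mult[symmetric]) (simp add: algebra_simps flip: exp_add)
    qed
    have "Li_sh (- int a) (- int b) z1 z2 / (z1 * z2)
        = (\<Sum>j\<le>b. of_nat (b choose j) *
      ((\<Sum>i\<le>a + j. of_int (rising_coeff (a + j) i) * inverse (1 - z1) ^ Suc i) *
       (\<Sum>l\<le>b - j. of_int (rising_coeff (b - j) l) * inverse (1 - z2) ^ Suc l)))"
      using nz z by (subst Li_sh_neg) (auto simp: z1_def z2_def)
    also have "\<dots> = (\<Sum>j\<le>b. \<Sum>i\<le>a + j. \<Sum>l\<le>b - j. C j i l *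
        (inverse (1 - z1) ^ Suc i * inverse (1 - z2) ^ Suc l))"
      by (simp only: C_def sum_product sum_distrib_left mult_ac)
    also have "\<dots> = (\<Sum>j\<le>b. \<Sum>i\<le>a + j. \<Sum>l\<le>b - j. C j i l *
        (exp (of_nat (Suc i) * x1) * exp (of_nat (Suc i + Suc l) * x2)))"
      unfolding inv ..
    finally have quot: "Li_sh (- int a) (- int b) z1 z2 / (z1 * z2) = \<dots>" .
    have "((\<lambda>q. \<Sum>j\<le>b. \<Sum>i\<le>a + j. \<Sum>l\<le>b - j. C j i l *
        (\<lambda>(m, n). ((of_nat (Suc i) * x1) ^ m / fact m) * ((of_nat (Suc i + Suc l) * x2) ^ n / fact n)) q)
        has_sum Li_sh (- int a) (- int b) z1 z2 / (z1 * z2)) (UNIV \<times> UNIV)"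
      unfolding quot
      by (intro has_sum_cmult_right has_sum_finite_sum has_sum_product_complex has_sum_exp)
    also have "(\<lambda>q. \<Sum>j\<le>b. \<Sum>i\<le>a + j. \<Sum>l\<le>b - j. C j i l *
        (\<lambda>(m, n). ((of_nat (Suc i) * x1) ^ m / fact m) * ((of_nat (Suc i + Suc l) * x2) ^ n / fact n)) q)
      = (\<lambda>(m, n). of_int (neg_double_poly_bernoulli a b m n) * (x1 ^ m * x2 ^ n / (fact m * fact n)))"
      by (simp add: fun_eq_iff neg_double_poly_bernoulli_def C_def sum_distrib_left sum_distrib_right sum_divide_distrib
          power_mult_distrib mult_ac del: of_nat_Suc of_nat_add)
    finally show "((\<lambda>(m, n). of_int (neg_double_poly_bernoulli a b m n) *
          (x1 ^ m * x2 ^ n / (fact m * fact n))) has_sum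
        Li_sh (- int a) (- int b) (1 - exp (- x1 - x2)) (1 - exp (- x2)) /
          ((1 - exp (- x1 - x2)) * (1 - exp (- x2)))) UNIV"
      by (simp add: z1_def z2_def)
  qed
qed

lemma double_poly_bernoulli_neg:
  "double_poly_bernoulli (- int a) (- int b) n1 n2 = of_int (neg_double_poly_bernoulli a b n1 n2)"
proof -
  have "double_poly_bernoulli (- int a) (- int b)
      = (\<lambda>n1 n2. of_int (neg_double_poly_bernoulli a b n1 n2))"
    unfolding double_poly_bernoulli_def
    by (rule the_equality)
      (auto intro: is_double_poly_bernoulli_neg is_double_poly_bernoulli_unique)
  then show ?thesis by simp
qed

section \<open>Periodicity modulo prime powers\<close>

text \<open>
  The bound \<open>N\<close> on the exponents is what makes both powers vanish modulo \<open>p ^ N\<close> when \<open>p\<close>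
  divides \<open>u\<close>; otherwise \<open>p ^ (N - 1) * (p - 1)\<close> is the totient of \<open>p ^ N\<close> and Euler's theorem applies.
\<close>

lemma power_cong_prime_power:
  fixes p u n m N :: nat
  assumes "prime p" and "N > 0" and "n \<ge> N" and "m \<ge> N"
    and "[n = m] (mod p ^ (N - 1) * (p - 1))"
  shows "[u ^ n = u ^ m] (mod p ^ N)"
  using assms(3-5)
proof (induction n m rule: linorder_wlog)
  case (le n m)
  show ?case
  proof (cases "p dvd u")
    case True
    then have "p ^ N dvd u ^ n" "p ^ N dvd u ^ m"
      using le by (auto intro: dvd_trans[OF dvd_power_same le_imp_power_dvd])
    then show ?thesis by (simp add: cong_def mod_eq_0_iff_dvd)
  next
    case False
    then have "coprime u (p ^ N)"
      using \<open>prime p\<close> by (metis coprime_commute coprime_power_right_iff prime_imp_coprime)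
    then have 1: "[u ^ (p ^ (N - 1) * (p - 1)) = 1] (mod p ^ N)"
      using euler_theorem totient_prime_power[OF \<open>prime p\<close> \<open>N > 0\<close>] by metis
    obtain q where q: "m = q * (p ^ (N - 1) * (p - 1)) + n"
      using le cong_le_nat cong_sym by metis
    have "u ^ m = u ^ n * (u ^ (p ^ (N - 1) * (p - 1))) ^ q"
      unfolding q power_add power_mult[symmetric] by (simp only: mult.commute)
    also have "[\<dots> = u ^ n * 1 ^ q] (mod p ^ N)"
      by (intro cong_mult cong_pow cong_refl 1)
    finally show ?thesis
      by (simp add: cong_sym)
  qed
next
  case (sym n m)
  then show ?case by (metis cong_sym)
qed

lemma neg_double_poly_bernoulli_cong:
  assumes "\<And>u :: nat. [u ^ n1 = u ^ n1'] (mod M)" and "\<And>u :: nat. [u ^ n2 = u ^ n2'] (mod M)"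
  shows "[neg_double_poly_bernoulli a b n1 n2 = neg_double_poly_bernoulli a b n1' n2'] (mod int M)"
  unfolding neg_double_poly_bernoulli_def
  by (intro cong_sum cong_mult cong_refl; simp only: of_nat_power[symmetric] cong_int_iff assms)

theorem theorem2p2:
  fixes k1 k2 N p n1 n2 m1 m2 :: nat
  assumes "k1 > 0" and "k2 > 0" and "N > 0"
    and "prime p"
    and "n1 > 0" and "n2 > 0" and "m1 > 0" and "m2 > 0"
    and "n1 \<ge> N" and "n2 \<ge> N" and "m1 \<ge> N" and "m2 \<ge> N"
    and "[n1 = m1] (mod p ^ (N - 1) * (p - 1))"
    and "[n2 = m2] (mod p ^ (N - 1) * (p - 1))"
  shows "cong_integers (double_poly_bernoulli (- int k1) (- int k2) n1 n2)
           (double_poly_bernoulli (- int k1) (- int k2) n1 m2) (int p ^ N)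
       \<and> cong_integers (double_poly_bernoulli (- int k1) (- int k2) n1 n2)
           (double_poly_bernoulli (- int k1) (- int k2) m1 n2) (int p ^ N)"
proof -
  have u: "[u ^ n1 = u ^ m1] (mod p ^ N)" "[u ^ n2 = u ^ m2] (mod p ^ N)" for u :: nat
    by (intro power_cong_prime_power assms)+
  show ?thesis
    unfolding double_poly_bernoulli_neg cong_integers_def of_nat_power[symmetric]
    using neg_double_poly_bernoulli_cong[OF cong_refl u(2)]
      neg_double_poly_bernoulli_cong[OF u(1) cong_refl]
    by blast
qed

end
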